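(* Let $M$ be an $m$-dimensional orientable vector manifold, and $f: M \to \mathcal{G}_M(x)$ an integrable function. Suppose there exist a sequence of orientable vector manifolds $N_0 \subset N_1 \subset \dots \subset N_m = M$, bounded sets $E_i\subset N_i$ ($1\le i\le m$), and functions $F_m=f, F_{m-1},\dots,F_0$ with values in the geometric algebra, such that (1) for each $0\le i\le m-1$: if $\partial N_{i+1}\neq\varnothing$, then $N_i=\partial N_{i+1}$ (and we put $E_{i+1}=\varnothing$); otherwise $N_i=\partial(N_{i+1}\setminus E_{i+1})$, where $E_{i+1}$ is a bounded set such that the boundary $\partial(N_{i+1}\setminus E_{i+1})$ is a non-empty vector manifold and $F_{i+1}$ is integrable and bounded on $E_{i+1}$; (2) for each $0\le i\le m-1$: $F_i$ is an antiderivative of $F_{i+1}$ on $N_{i+1}\setminus E_{i+1}$ (a manifold with boundary $N_i$) with respect to the derivative on $N_{i+1}$, i.e. $\partial_{N_{i+1}}F_i=F_{i+1}$ on $N_{i+1}\setminus E_{i+1}$, and $F_i$ is bounded on $N_i$; (3) $N_0$ is a finite set. Then the integral of $f$ over $M$ can be computed by evaluating the $m$-th antiderivative $F_0$ on $N_0$: $$\left\| \int_M d^m x\, f(x) - \sum_{x_j\in N_0} s_j\, F_0(x_j)\right\| \leq \epsilon,\qquad \epsilon = \Big(\max_{1\le i\le m}\ \sup_{x \in E_i}\|F_i(x)\|\Big)\ \sum_{i=1}^m \mathrm{vol}(E_i),$$ where the signs $s_j \in \{-1, 1\}$ are determined by fulfilling, at each step, the requirement on the orientation of the boundary in the fundamental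 theorem of calculus (a supremum over an empty set is taken to be $0$).
   Context: All inner products are positive definite. A (Euclidean) vector manifold $M$ is a manifold (possibly with boundary) embedded in a Euclidean space $\mathbb{R}^n$, its points being regarded as vectors of the geometric algebra (real Clifford algebra, $v^2=\|v\|^2$ for vectors) $\mathcal{G}(\mathbb{R}^n)$. The tangent algebra $\mathcal{G}_M(x)$ at $x\in M$ is the geometric algebra generated by $T_xM$. For multivectors, $\langle\cdot\rangle$ is the scalar part, $\tilde{B}$ is the reverse of $B$, $A\ast B=\langle A\tilde{B}\rangle$, and $\|A\|^2=A\ast A$. Directed integral: an orientation of a $k$-dimensional manifold $N$ is a continuous choice of unit pseudoscalar $I_N(x)\in\mathcal{G}_N(x)$ (unit $k$-blade representing $T_xN$). The directed measure is $d^k x=I_N(x)\|d^k x\|$, with $\|d^k x\|$ the ordinary scalar $k$-dimensional volume measure, and $\int_N d^k x\,g(x)=\int_N\|d^k x\|\,I_N(x)g(x)$ (pseudoscalar to the left of the integrand, geometric product). A function $g$ is integrable if each scalar function $a^I(x)\ast(I_N(x)g(x))$ is integrable with respect to $\|d^k x\|$, where $\{a^I(x)\}_I$ is a multivector basis of the algebra; scalar integrability is in a fixed standard sense (such as Riemann or Lebesgue). $\mathrm{vol}(E_i)$ is the $i$-dimensional volume of $E_i\subset N_i$. Vector derivative: on a vector manifold $N$, $\partial_N=\sum_i p_{N_x}(e_i)\,(e_i\cdot\partial)$, where $\{e_i\}$ is an orthonormal basis of the surrounding tangent space, $e_i\cdot\partial$ is the directional derivative along $e_i$, and $p_{N_x}$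 is the orthogonal projection onto $T_xN$; equivalently $\partial_N g(x)=\sum_j t_j\,(t_j\cdot\partial)g(x)$ for an orthonormal basis $\{t_j\}$ of $T_xN$, the vectors $t_j$ multiplying by the geometric product. The result may take values in the full geometric algebra, not only in $\mathcal{G}_N(x)$. The manifolds $N_i$ have dimension $i$. It is a standing assumption that the manifolds and antiderivatives are regular enough for the fundamental theorem of calculus to apply at each step. That theorem reads: for an oriented $k$-dimensional vector manifold $N$ with unit pseudoscalar $I_N$, whose boundary $\partial N$ is a vector manifold, and a differentiable multivector function $g$ on $N$, $$\int_N d^k x\,\partial_N g(x)=\int_{\partial N}d^{k-1}x\,g(x),$$ where $d^{k-1}x$ is oriented so that $I_N(x)\|d^{k-1}x\|=d^{k-1}x\,n(x)$, with $n(x)$ the outward unit normal of $\partial N$ at $x$. It is applied with $N=N_{i+1}\setminus E_{i+1}$, $\partial N=N_i$, $g=F_i$, for $i=m-1,\dots,0$; this orientation rule successively fixes the orientation of each $N_i$ from that of $N_{i+1}$, starting from the orientation of $M$. For $k=1$, $d^0x$ is a signed counting measure: the sign $s_j$ at $x_j\in N_0$ is $+1$ if the unit tangent pseudoscalar of $N_1$ at $x_j$ equals the outward normal $n(x_j)$ of $N_1\setminus E_1$, and $-1$ if it equals $-n(x_j)$. *)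

theory Defs
  imports "HOL-Analysis.Analysis"
begin

section \<open>The geometric algebra of a Euclidean space\<close>

type_synonym 'n vector = "(real, 'n) vec"

text \<open>
  The coefficient at \<open>A = {i\<^sub>1 < \<dots> < i\<^sub>p}\<close> is that of the basis blade
  \<open>e\<^sub>A = e\<^bsub>i\<^sub>1\<^esub> \<cdots> e\<^bsub>i\<^sub>p\<^esub>\<close>, where \<open>e\<^sub>i = axis i 1\<close> is the standard orthonormal basis. The linear
  order on the index type only fixes the order of the factors.
\<close>
type_synonym 'n multivector = "(real, 'n set) vec"

abbreviation blade :: "'n::finite set \<Rightarrow> 'n multivector" where
  "blade A \<equiv> axis A 1"

text \<open>
  \<open>e\<^sub>A e\<^sub>B = \<plusminus> e\<^bsub>A \<triangle> B\<^esub>\<close>: sorting the factors takes one transposition of anticommuting vectors for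
  each inversion, and repeated factors cancel because \<open>e\<^sub>i\<^sup>2 = 1\<close>.
\<close>
definition blade_sign :: "'n::linorder set \<Rightarrow> 'n set \<Rightarrow> real" where
  "blade_sign A B = (-1) ^ card {(a, b). a \<in> A \<and> b \<in> B \<and> b < a}"

definition gprod :: "('n::{finite,linorder}) multivector \<Rightarrow> 'n multivector \<Rightarrow> 'n multivector"
    (infixl "\<odot>" 70) where
  "X \<odot> Y = (\<Sum>A\<in>UNIV. \<Sum>B\<in>UNIV. (X $ A * Y $ B * blade_sign A B) *\<^sub>R blade (sym_diff A B))"

abbreviation mv_one :: "('n::finite) multivector" where
  "mv_one \<equiv> blade {}"

definition mv_of_vec :: "'n vector \<Rightarrow> ('n::finite) multivector" where
  "mv_of_vec v = (\<Sum>i\<in>UNIV. v $ i *\<^sub>R blade {i})"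

definition mv_scalar :: "('n::finite) multivector \<Rightarrow> real" where
  "mv_scalar X = X $ {}"

text \<open>Reversing \<open>p\<close> anticommuting factors takes \<open>p (p - 1) / 2\<close> transpositions.\<close>
definition mv_reverse :: "('n::finite) multivector \<Rightarrow> 'n multivector" where
  "mv_reverse X = (\<chi> A. (-1) ^ (card A * (card A - 1) div 2) * X $ A)"

definition mv_inner :: "('n::{finite,linorder}) multivector \<Rightarrow> 'n multivector \<Rightarrow> real" where
  "mv_inner X Y = mv_scalar (X \<odot> mv_reverse Y)"

definition mv_norm :: "('n::{finite,linorder}) multivector \<Rightarrow> real" where
  "mv_norm X = sqrt (mv_inner X X)"

inductive_set generated_algebra :: "('n::{finite,linorder}) vector set \<Rightarrow> 'n multivector set"
  for T :: "('n::{finite,linorder}) vector set" where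
  scalar: "c *\<^sub>R mv_one \<in> generated_algebra T"
| vector: "v \<in> T \<Longrightarrow> mv_of_vec v \<in> generated_algebra T"
| add: "X \<in> generated_algebra T \<Longrightarrow> Y \<in> generated_algebra T \<Longrightarrow> X + Y \<in> generated_algebra T"
| mult: "X \<in> generated_algebra T \<Longrightarrow> Y \<in> generated_algebra T \<Longrightarrow> X \<odot> Y \<in> generated_algebra T"

subsection \<open>The Clifford relations\<close>

lemma blade_sign_prod:
  fixes A B :: "'n::{finite,linorder} set"
  shows "blade_sign A B = (\<Prod>a\<in>A. \<Prod>b\<in>B. if b < a then -1 else 1)"
proof -
  have "{(a, b). a \<in> A \<and> b \<in> B \<and> b < a} = A \<times> B \<inter> {p. snd p < fst p}" by auto
  then show ?thesis
    by (simp del: prod_constant prod.If_cases add: blade_sign_def prod.cartesian_product case_prod_unfold)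
       (simp add: prod.If_cases)
qed

lemma prod_sym_diff:
  fixes f :: "'n::finite \<Rightarrow> real"
  assumes "\<And>x. f x * f x = 1"
  shows "prod f (sym_diff A B) = prod f A * prod f B"
proof -
  have sq: "prod f S * prod f S = 1" for S
    by (simp add: assms flip: prod.distrib)
  have split: "prod f S = prod f (S - S') * prod f (S \<inter> S')" for S S'
  proof -
    have "(S - S') \<union> (S \<inter> S') = S" by blast
    then show ?thesis
      using prod.union_disjoint[of "S - S'" "S \<inter> S'" f] by (simp add: Diff_Int_distrib2)
  qed
  have "prod f A * prod f B =
      prod f (A - B) * prod f (B - A) * (prod f (A \<inter> B) * prod f (A \<inter> B))"
    unfolding split[of A B] split[of B A] Int_commute[of B A] by (simp only: ac_simps)
  also have "\<dots> = prod f (sym_diff A B)"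
    unfolding sq by (subst prod.union_disjoint) auto
  finally show ?thesis by (rule sym)
qed

lemma blade_sign_sym_diff_left:
  fixes A B C :: "'n::{finite,linorder} set"
  shows "blade_sign (sym_diff A B) C = blade_sign A C * blade_sign B C"
  unfolding blade_sign_prod
  by (rule prod_sym_diff, unfold prod.distrib[symmetric], rule prod.neutral) simp

lemma blade_sign_sym_diff_right:
  fixes A B C :: "'n::{finite,linorder} set"
  shows "blade_sign A (sym_diff B C) = blade_sign A B * blade_sign A C"
  unfolding blade_sign_prod prod.distrib[symmetric] by (intro prod.cong refl prod_sym_diff) auto

lemma bilinear_gprod: "bilinear (gprod :: ('n::{finite,linorder}) multivector \<Rightarrow> _)"
  unfolding bilinear_def gprod_def
  by (auto intro!: linearI simp: algebra_simps sum.distrib scaleR_sum_right)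

lemma gprod_blade: "blade A \<odot> blade B = blade_sign A B *\<^sub>R blade (sym_diff A B)"
proof -
  have "blade A \<odot> blade B = (\<Sum>A'\<in>UNIV. \<Sum>B'\<in>UNIV.
      (of_bool (A' = A) * of_bool (B' = B) * blade_sign A' B') *\<^sub>R blade (sym_diff A' B'))"
    unfolding gprod_def axis_def by (simp add: of_bool_def)
  also have "\<dots> = (\<Sum>A'\<in>UNIV. if A' = A then
      (blade_sign A' B *\<^sub>R blade (sym_diff A' B)) else 0)"
  proof (rule sum.cong[OF refl])
    fix A'
    have "(\<Sum>B'\<in>UNIV. (of_bool (A' = A) * of_bool (B' = B) * blade_sign A' B') *\<^sub>R blade (sym_diff A' B'))
        = (\<Sum>B'\<in>UNIV. if B' = B then of_bool (A' = A) *\<^sub>R blade_sign A' B' *\<^sub>R blade (sym_diff A' B') else 0)"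
      by (rule sum.cong[OF refl]) simp
    also have "\<dots> = of_bool (A' = A) *\<^sub>R blade_sign A' B *\<^sub>R blade (sym_diff A' B)"
      by (rule trans[OF sum.delta]) simp_all
    finally show "(\<Sum>B'\<in>UNIV. (of_bool (A' = A) * of_bool (B' = B) * blade_sign A' B') *\<^sub>R blade (sym_diff A' B'))
        = (if A' = A then blade_sign A' B *\<^sub>R blade (sym_diff A' B) else 0)"
      by simp
  qed
  also have "\<dots> = blade_sign A B *\<^sub>R blade (sym_diff A B)"
    by (rule trans[OF sum.delta]) simp_all
  finally show ?thesis .
qed

lemma multivector_expansion: "X = (\<Sum>A\<in>UNIV. X $ A *\<^sub>R blade A)"
  by (simp add: vec_eq_iff axis_def if_distrib cong: if_cong)

lemma multivector_linear_eqI: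
  fixes f g :: "('n::finite) multivector \<Rightarrow> 'b::real_vector"
  assumes "linear f" "linear g" "\<And>A. f (blade A) = g (blade A)"
  shows "f X = g X"
  by (subst (1 2) multivector_expansion)
     (simp add: linear_sum[OF assms(1)] linear_sum[OF assms(2)] linear_scale[OF assms(1)]
       linear_scale[OF assms(2)] assms(3))

lemmas gprod_left_simps = bilinear_ladd[OF bilinear_gprod] bilinear_lmul[OF bilinear_gprod]
lemmas gprod_right_simps = bilinear_radd[OF bilinear_gprod] bilinear_rmul[OF bilinear_gprod]

lemma gprod_assoc: "(X \<odot> Y) \<odot> Z = X \<odot> (Y \<odot> Z)"
proof -
  have sd: "sym_diff (sym_diff A B) C = sym_diff A (sym_diff B C)" for A B C :: "'a set" by blast
  have 0: "(blade A \<odot> blade B) \<odot> blade C = blade A \<odot> (blade B \<odot> blade C)" for A B C :: "'a set"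
    by (simp only: gprod_blade bilinear_lmul[OF bilinear_gprod] bilinear_rmul[OF bilinear_gprod]
        scaleR_scaleR blade_sign_sym_diff_left blade_sign_sym_diff_right sd) (simp add: ac_simps)
  have 1: "(blade A \<odot> blade B) \<odot> Z = blade A \<odot> (blade B \<odot> Z)" for A B
    by (rule multivector_linear_eqI[where X = Z])
       (auto intro!: linearI simp: gprod_right_simps 0)
  have 2: "(blade A \<odot> Y) \<odot> Z = blade A \<odot> (Y \<odot> Z)" for A
    by (rule multivector_linear_eqI[where X = Y])
       (auto intro!: linearI simp: gprod_left_simps gprod_right_simps 1)
  show ?thesis
    by (rule multivector_linear_eqI[where X = X])
       (auto intro!: linearI simp: gprod_left_simps gprod_right_simps 2)
qed

lemma gprod_one: "mv_one \<odot> X = X" "X \<odot> mv_one = X"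
  by (rule multivector_linear_eqI[where X = X];
      auto intro!: linearI simp: gprod_left_simps gprod_right_simps gprod_blade blade_sign_def)+

lemma mv_of_vec_square: "mv_of_vec v \<odot> mv_of_vec v = (norm v)\<^sup>2 *\<^sub>R mv_one"
proof -
  let ?t = "\<lambda>i j. (v $ i * v $ j) *\<^sub>R (blade {i} \<odot> blade {j})"
  have swap: "?t i j + ?t j i = (if i = j then (2 * (v $ i)\<^sup>2) *\<^sub>R mv_one else 0)" for i j
  proof -
    have "{(a, b). a = i \<and> b = j \<and> b < a} = (if j < i then {(i, j)} else {})" for i j :: 'a by auto
    then have "blade_sign {i} {j} = (if j < i then -1 else 1)" for i j :: 'a
      by (simp add: blade_sign_def)
    then show ?thesis
      by (auto simp: gprod_blade Un_commute power2_eq_square simp flip: scaleR_add_left)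
  qed
  have "mv_of_vec v \<odot> mv_of_vec v = (\<Sum>i\<in>UNIV. \<Sum>j\<in>UNIV. ?t i j)" (is "_ = ?S")
    unfolding mv_of_vec_def bilinear_sum[OF bilinear_gprod] sum.cartesian_product
    by (rule sum.cong[OF refl])
       (auto simp: bilinear_lmul[OF bilinear_gprod] bilinear_rmul[OF bilinear_gprod])
  moreover have "?S + ?S = (\<Sum>i\<in>UNIV. \<Sum>j\<in>UNIV. ?t i j + ?t j i)"
    unfolding sum.distrib by (subst (4) sum.swap) (rule refl)
  moreover have "\<dots> = (2 * (norm v)\<^sup>2) *\<^sub>R mv_one"
    by (simp only: swap) (simp add: norm_vec_def L2_set_def sum_nonneg sum_distrib_left
        flip: scaleR_sum_left)
  ultimately have "2 *\<^sub>R ?S = 2 *\<^sub>R ((norm v)\<^sup>2 *\<^sub>R mv_one)"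
    by (simp add: scaleR_2)
  then have "?S = (norm v)\<^sup>2 *\<^sub>R mv_one"
    by (rule scaleR_left_imp_eq[rotated]) simp
  then show ?thesis
    using \<open>mv_of_vec v \<odot> mv_of_vec v = ?S\<close> by simp
qed

lemma mv_inner_eq: "mv_inner X Y = X \<bullet> Y"
proof -
  have sign: "blade_sign A A * (-1) ^ (card A * (card A - 1) div 2) = 1" for A :: "'a set"
  proof -
    let ?I = "{(a, b). a \<in> A \<and> b \<in> A \<and> b < a}"
    have "A \<times> A = Id_on A \<union> (?I \<union> ?I\<inverse>)" by (auto simp: Id_on_def)
    also have "card \<dots> = card (Id_on A) + (card ?I + card (?I\<inverse>))"
      by (subst card_Un_disjoint; (subst card_Un_disjoint)?) (auto simp: finite_subset[of _ UNIV])
    also have "card (Id_on A) = card A"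
    proof -
      have "Id_on A = (\<lambda>x. (x, x)) ` A" by auto
      then show ?thesis by (simp add: card_image inj_on_def)
    qed
    finally have "card A * card A = card A + 2 * card ?I"
      by (simp add: card_cartesian_product)
    then have "card ?I = card A * (card A - 1) div 2"
      by (simp add: diff_mult_distrib2)
    then show ?thesis
      by (simp add: blade_sign_def flip: power_add mult_2)
  qed
  have "mv_inner X Y = (\<Sum>A\<in>UNIV. \<Sum>B\<in>UNIV. if A = B then X $ A * Y $ A else 0)"
  proof -
    have "(X $ A * (mv_reverse Y) $ B * blade_sign A B) * (blade (sym_diff A B) $ {})
        = (if A = B then X $ A * Y $ A else 0)" for A B
      using sign[of A] by (auto simp: axis_def mv_reverse_def ac_simps)
    then show ?thesis
      by (simp add: mv_inner_def mv_scalar_def gprod_def)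
  qed
  then show ?thesis by (simp add: inner_vec_def)
qed

lemma mv_norm_eq: "mv_norm X = norm X"
  by (simp add: mv_norm_def mv_inner_eq norm_eq_sqrt_inner)

section \<open>Vector manifolds\<close>

definition C1_on :: "('a::real_normed_vector \<Rightarrow> 'b::real_normed_vector) \<Rightarrow> 'a set \<Rightarrow> bool" where
  "C1_on f W \<longleftrightarrow> (\<exists>f'. continuous_on W f' \<and>
     (\<forall>x\<in>W. (f has_derivative blinfun_apply (f' x)) (at x)))"

definition C1_diffeomorphism where
  "C1_diffeomorphism W W' \<phi> \<psi> \<longleftrightarrow>
     open W \<and> open W' \<and> homeomorphism W W' \<phi> \<psi> \<and> C1_on \<phi> W \<and> C1_on \<psi> W'"

definition manifold_interior_point :: "nat \<Rightarrow> ('a::euclidean_space) set \<Rightarrow> 'a \<Rightarrow> bool" where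
  "manifold_interior_point k N x \<longleftrightarrow> (\<exists>W W' \<phi> \<psi> L :: 'a set.
     C1_diffeomorphism W W' \<phi> \<psi> \<and> x \<in> W \<and> subspace L \<and> dim L = k \<and> \<phi> ` (N \<inter> W) = L \<inter> W')"

definition manifold_boundary_point :: "nat \<Rightarrow> ('a::euclidean_space) set \<Rightarrow> 'a \<Rightarrow> bool" where
  "manifold_boundary_point k N x \<longleftrightarrow> (\<exists>W W' \<phi> \<psi> u. \<exists>L :: 'a set.
     C1_diffeomorphism W W' \<phi> \<psi> \<and> x \<in> W \<and> subspace L \<and> dim L = k \<and> u \<in> L \<and> u \<noteq> 0 \<and>
     \<phi> ` (N \<inter> W) = {y \<in> L. 0 \<le> y \<bullet> u} \<inter> W' \<and> \<phi> x \<bullet> u = 0)"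

definition vector_manifold :: "nat \<Rightarrow> ('a::euclidean_space) set \<Rightarrow> bool" where
  "vector_manifold k N \<longleftrightarrow>
     (\<forall>x\<in>N. manifold_interior_point k N x \<or> manifold_boundary_point k N x)"

definition manifold_boundary :: "nat \<Rightarrow> ('a::euclidean_space) set \<Rightarrow> 'a set" where
  "manifold_boundary k N = {x \<in> N. manifold_boundary_point k N x}"

text \<open>
  One-sided velocities, so that the tangent space at a boundary point, their span, has the full
  dimension of the manifold.
\<close>
definition velocities :: "('a::euclidean_space) set \<Rightarrow> 'a \<Rightarrow> 'a set" where
  "velocities N x = {v. \<exists>\<gamma> \<epsilon>. 0 < \<epsilon> \<and> \<gamma> 0 = x \<and> \<gamma> ` {0..\<epsilon>} \<subseteq> N \<and>
     (\<gamma> has_vector_derivative v) (at (0::real) within {0..\<epsilon>})}"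

definition tangent_space :: "('a::euclidean_space) set \<Rightarrow> 'a \<Rightarrow> 'a set" where
  "tangent_space N x = span (velocities N x)"

definition tangent_algebra :: "('n::{finite,linorder}) vector set \<Rightarrow> 'n vector \<Rightarrow> 'n multivector set" where
  "tangent_algebra N x = generated_algebra (tangent_space N x)"

text \<open>The vector is outward because no curve in \<open>N\<close> starting at \<open>x\<close> has velocity on its side.\<close>
definition outward_normal :: "nat \<Rightarrow> ('a::euclidean_space) set \<Rightarrow> 'a \<Rightarrow> 'a" where
  "outward_normal k N x = (THE n. n \<in> tangent_space N x \<and> norm n = 1 \<and>
     (\<forall>t \<in> tangent_space (manifold_boundary k N) x. n \<bullet> t = 0) \<and>
     (\<forall>v \<in> velocities N x. n \<bullet> v \<le> 0))"

subsection \<open>Orientation\<close>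

definition orthonormal :: "('a::euclidean_space) list \<Rightarrow> bool" where
  "orthonormal ts \<longleftrightarrow> distinct ts \<and> pairwise orthogonal (set ts) \<and> (\<forall>t \<in> set ts. norm t = 1)"

text \<open>The sign is needed only for the empty list: the unit \<open>0\<close>-blades are \<open>\<plusminus> 1\<close>.\<close>
definition unit_pseudoscalar ::
    "nat \<Rightarrow> ('n::{finite,linorder}) vector set \<Rightarrow> 'n multivector \<Rightarrow> bool" where
  "unit_pseudoscalar k T J \<longleftrightarrow> (\<exists>ts s. orthonormal ts \<and> length ts = k \<and> span (set ts) = T \<and>
     s \<in> {-1, 1} \<and> J = s *\<^sub>R foldr (\<odot>) (map mv_of_vec ts) mv_one)"

definition orientation ::
    "nat \<Rightarrow> ('n::{finite,linorder}) vector set \<Rightarrow> ('n vector \<Rightarrow> 'n multivector) \<Rightarrow> bool" where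
  "orientation k N J \<longleftrightarrow>
     continuous_on N J \<and> (\<forall>x\<in>N. unit_pseudoscalar k (tangent_space N x) (J x))"

text \<open>\<open>K\<close> is the orientation that \<open>J\<close> induces on the boundary of the \<open>(k + 1)\<close>-dimensional \<open>N\<close>.\<close>
definition boundary_orientation :: "nat \<Rightarrow> ('n::{finite,linorder}) vector set \<Rightarrow>
    ('n vector \<Rightarrow> 'n multivector) \<Rightarrow> ('n vector \<Rightarrow> 'n multivector) \<Rightarrow> bool" where
  "boundary_orientation k N J K \<longleftrightarrow> orientation k (manifold_boundary (Suc k) N) K \<and>
     (\<forall>x \<in> manifold_boundary (Suc k) N. J x = K x \<odot> mv_of_vec (outward_normal (Suc k) N x))"

text \<open>For a \<open>1\<close>-dimensional \<open>N\<close> the only alternative is that \<open>J x\<close> is minus the outward normal.\<close>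
definition endpoint_sign :: "('n::{finite,linorder}) vector set \<Rightarrow>
    ('n vector \<Rightarrow> 'n multivector) \<Rightarrow> 'n vector \<Rightarrow> real" where
  "endpoint_sign N J x = (if J x = mv_of_vec (outward_normal 1 N x) then 1 else -1)"

section \<open>Volume and directed integrals\<close>

text \<open>Hausdorff measure, normalised to agree with Lebesgue measure on \<open>k\<close>-dimensional subspaces.\<close>
definition hausdorff_premeasure :: "nat \<Rightarrow> real \<Rightarrow> ('a::metric_space) set \<Rightarrow> ennreal" where
  "hausdorff_premeasure k \<delta> A =
     (INF U \<in> {U :: nat \<Rightarrow> 'a set. A \<subseteq> (\<Union>j. U j) \<and> (\<forall>j. bounded (U j) \<and> diameter (U j) \<le> \<delta>)}.
        \<Sum>j. ennreal (unit_ball_vol (real k) * (diameter (U j) / 2) ^ k))"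

definition hausdorff_outer :: "nat \<Rightarrow> ('a::metric_space) set \<Rightarrow> ennreal" where
  "hausdorff_outer k A = (SUP \<delta>\<in>{0<..}. hausdorff_premeasure k \<delta> A)"

definition volume_measure :: "nat \<Rightarrow> ('a::metric_space) measure" where
  "volume_measure k = (if k = 0 then count_space UNIV
     else measure_of UNIV (lambda_system UNIV (Pow UNIV) (hausdorff_outer k)) (hausdorff_outer k))"

text \<open>For measurable \<open>A\<close> this is the measure of \<open>A\<close>.\<close>
definition vol :: "nat \<Rightarrow> ('a::metric_space) set \<Rightarrow> ennreal" where
  "vol k A = outer_measure_of (volume_measure k) A"

definition directed_integrable :: "nat \<Rightarrow> ('n::{finite,linorder}) vector set \<Rightarrow>
    ('n vector \<Rightarrow> 'n multivector) \<Rightarrow> ('n vector \<Rightarrow> 'n multivector) \<Rightarrow> bool" where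
  "directed_integrable k N J g \<longleftrightarrow>
     (\<forall>A. set_integrable (volume_measure k) N (\<lambda>x. mv_inner (blade A) (J x \<odot> g x)))"

definition directed_integral :: "nat \<Rightarrow> ('n::{finite,linorder}) vector set \<Rightarrow>
    ('n vector \<Rightarrow> 'n multivector) \<Rightarrow> ('n vector \<Rightarrow> 'n multivector) \<Rightarrow> 'n multivector" where
  "directed_integral k N J g = (LINT x:N|volume_measure k. J x \<odot> g x)"

subsection \<open>The volume measure is a measure\<close>

lemma hausdorff_outer_measure_space:
  assumes "0 < k"
  shows "outer_measure_space (Pow UNIV) (hausdorff_outer k :: ('a::metric_space) set \<Rightarrow> ennreal)"
proof -
  let ?c = "\<lambda>U::'a set. ennreal (unit_ball_vol (real k) * (diameter U / 2) ^ k)"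
  have "hausdorff_premeasure k \<delta> ({}::'a set) = 0" if "0 < \<delta>" for \<delta>
  proof -
    have "hausdorff_premeasure k \<delta> ({}::'a set) \<le> (\<Sum>j::nat. ?c {})"
      unfolding hausdorff_premeasure_def using that by (intro INF_lower2[of "\<lambda>_. {}"]) auto
    with assms show ?thesis by (simp add: zero_power)
  qed
  then have "positive (Pow UNIV) (hausdorff_outer k :: 'a set \<Rightarrow> ennreal)"
    by (simp add: positive_def hausdorff_outer_def)
  moreover have "increasing (Pow UNIV) (hausdorff_outer k :: 'a set \<Rightarrow> ennreal)"
    unfolding increasing_def hausdorff_outer_def hausdorff_premeasure_def
    by (intro ballI impI SUP_mono' INF_superset_mono) auto
  moreover have "countably_subadditive (Pow UNIV) (hausdorff_outer k :: 'a set \<Rightarrow> ennreal)"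
    unfolding countably_subadditive_def
  proof (intro allI impI)
    fix A :: "nat \<Rightarrow> 'a set"
    show "hausdorff_outer k (\<Union>i. A i) \<le> (\<Sum>i. hausdorff_outer k (A i))"
      unfolding hausdorff_outer_def[of k "\<Union>i. A i"]
    proof (rule SUP_least)
      fix \<delta> :: real assume \<delta>: "\<delta> \<in> {0<..}"
      show "hausdorff_premeasure k \<delta> (\<Union>i. A i) \<le> (\<Sum>i. hausdorff_outer k (A i))"
      proof (rule ennreal_le_epsilon)
        fix e :: real assume e: "0 < e" and fin: "(\<Sum>n. hausdorff_outer k (A n)) < top"
        have le: "hausdorff_premeasure k \<delta> (A n) \<le> hausdorff_outer k (A n)" for n
          unfolding hausdorff_outer_def using \<delta> by (rule SUP_upper)
        have "hausdorff_outer k (A n) < hausdorff_outer k (A n) + e * (1/2)^Suc n" for n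
          using fin e by (auto simp add: less_top dest!: ennreal_suminf_lessD)
        then have "\<forall>n. \<exists>U. A n \<subseteq> (\<Union>j. U j) \<and> (\<forall>j. bounded (U j) \<and> diameter (U j) \<le> \<delta>) \<and>
            (\<Sum>j. ?c (U j)) < hausdorff_outer k (A n) + e * (1/2)^Suc n"
          using le_less_trans[OF le] unfolding hausdorff_premeasure_def INF_less_iff by blast
        then obtain U where U: "\<And>n. A n \<subseteq> (\<Union>j. U n j)" "\<And>n j. bounded (U n j)"
            "\<And>n j. diameter (U n j) \<le> \<delta>"
            "\<And>n. (\<Sum>j. ?c (U n j)) < hausdorff_outer k (A n) + e * (1/2)^Suc n"
          by metis
        define C where "C = case_prod U \<circ> prod_decode"
        have "(\<Union>i. A i) \<subseteq> (\<Union>i. C i)"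
          using U(1) by (auto simp add: C_def subset_eq) (metis prod.case prod_encode_inverse)
        then have "hausdorff_premeasure k \<delta> (\<Union>i. A i) \<le> (\<Sum>j. ?c (C j))"
          unfolding hausdorff_premeasure_def
          by (intro INF_lower) (auto simp: C_def U split: prod.split)
        also have "\<dots> = (\<Sum>n. \<Sum>j. ?c (U n j))"
          unfolding C_def comp_def
          by (subst suminf_ennreal_2dimen[symmetric, where f = "\<lambda>p. ?c (case_prod U p)"]) auto
        also have "\<dots> \<le> (\<Sum>n. hausdorff_outer k (A n) + e * (1/2) ^ Suc n)"
          by (intro suminf_le allI less_imp_le[OF U(4)]) auto
        also have "\<dots> = (\<Sum>n. hausdorff_outer k (A n)) + (\<Sum>n. ennreal e * ennreal ((1/2) ^ Suc n))"
          using e by (subst suminf_add[symmetric])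
            (auto simp del: ennreal_suminf_cmult simp add: ennreal_mult[symmetric])
        also have "\<dots> = (\<Sum>n. hausdorff_outer k (A n)) + e"
          unfolding ennreal_suminf_cmult
          by (subst suminf_ennreal_eq[OF zero_le_power power_half_series]) auto
        finally show "hausdorff_premeasure k \<delta> (\<Union>i. A i) \<le> (\<Sum>n. hausdorff_outer k (A n)) + e" .
      qed
    qed
  qed
  ultimately show ?thesis by (simp add: outer_measure_space_def)
qed

lemma
  assumes "0 < k"
  shows sets_volume_measure:
      "sets (volume_measure k) = lambda_system UNIV (Pow UNIV) (hausdorff_outer k)"
    and emeasure_volume_measure:
      "A \<in> sets (volume_measure k) \<Longrightarrow> emeasure (volume_measure k) A = hausdorff_outer k A"
proof -
  have ms: "measure_space UNIV (lambda_system UNIV (Pow UNIV) (hausdorff_outer k)) (hausdorff_outer k)"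
    by (rule sigma_algebra.caratheodory_lemma[OF sigma_algebra_Pow])
       (rule hausdorff_outer_measure_space[OF assms])
  then have sa: "sigma_algebra UNIV (lambda_system UNIV (Pow UNIV) (hausdorff_outer k))"
    and pos: "positive (lambda_system UNIV (Pow UNIV) (hausdorff_outer k)) (hausdorff_outer k)"
    and ca: "countably_additive (lambda_system UNIV (Pow UNIV) (hausdorff_outer k)) (hausdorff_outer k)"
    unfolding measure_space_def by blast+
  show sets: "sets (volume_measure k) = lambda_system UNIV (Pow UNIV) (hausdorff_outer k)"
    using assms sigma_algebra.sets_measure_of_eq[OF sa] unfolding volume_measure_def by simp
  show "emeasure (volume_measure k) A = hausdorff_outer k A" if "A \<in> sets (volume_measure k)"
    using assms emeasure_measure_of_sigma[OF sa pos ca that[unfolded sets]]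
    unfolding volume_measure_def by simp
qed

section \<open>The vector derivative\<close>

text \<open>
  The value \<open>(t \<bullet> \<partial>) g(x)\<close> for tangent \<open>t\<close> is determined by \<open>g\<close> on \<open>N\<close>, and the sum does not
  depend on the orthonormal basis. At a boundary point the derivative is one-sided.
\<close>
definition geometric_derivative :: "('n::{finite,linorder}) vector set \<Rightarrow>
    ('n vector \<Rightarrow> 'n multivector) \<Rightarrow> 'n vector \<Rightarrow> 'n multivector" where
  "geometric_derivative N g x =
     (let ts = (SOME ts. orthonormal ts \<and> span (set ts) = tangent_space N x)
      in \<Sum>t\<leftarrow>ts. mv_of_vec t \<odot> frechet_derivative g (at x within N) t)"

definition antiderivative_on :: "('n::{finite,linorder}) vector set \<Rightarrow>
    ('n vector \<Rightarrow> 'n multivector) \<Rightarrow> ('n vector \<Rightarrow> 'n multivector) \<Rightarrow> bool" where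
  "antiderivative_on N G g \<longleftrightarrow>
     (\<forall>x\<in>N. G differentiable (at x within N) \<and> geometric_derivative N G x = g x)"

text \<open>
  The regularity of \<open>N\<close> and \<open>g\<close> under which the fundamental theorem of calculus may be applied to
  them: both sides exist and agree.
\<close>
definition fundamental_theorem_applies :: "nat \<Rightarrow> ('n::{finite,linorder}) vector set \<Rightarrow>
    ('n vector \<Rightarrow> 'n multivector) \<Rightarrow> ('n vector \<Rightarrow> 'n multivector) \<Rightarrow> bool" where
  "fundamental_theorem_applies k N J g \<longleftrightarrow> (\<forall>K. boundary_orientation k N J K \<longrightarrow>
     directed_integrable (Suc k) N J (geometric_derivative N g) \<and>
     directed_integrable k (manifold_boundary (Suc k) N) K g \<and>
     directed_integral (Suc k) N J (geometric_derivative N g) =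
       directed_integral k (manifold_boundary (Suc k) N) K g)"

end

theory Submission
  imports Defs
begin

text \<open>
  Write \<open>S\<^sub>i\<close> for the directed integral of \<open>F\<^sub>i\<close> over \<open>N\<^sub>i\<close>. Since \<open>E\<^bsub>i+1\<^esub>\<close> lies in \<open>N\<^bsub>i+1\<^esub>\<close>, the
  integral \<open>S\<^bsub>i+1\<^esub>\<close> is the sum of the integrals of \<open>F\<^bsub>i+1\<^esub>\<close> over \<open>N\<^bsub>i+1\<^esub> - E\<^bsub>i+1\<^esub>\<close> and over \<open>E\<^bsub>i+1\<^esub>\<close>. The
  first of these is \<open>S\<^sub>i\<close> by the fundamental theorem of calculus, because \<open>F\<^bsub>i+1\<^esub>\<close> is the vector
  derivative of \<open>F\<^sub>i\<close> there and the boundary is \<open>N\<^sub>i\<close>. The second has norm at most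
  \<open>sup \<parallel>F\<^bsub>i+1\<^esub>\<parallel> vol(E\<^bsub>i+1\<^esub>)\<close>. So a descent by one dimension costs at most this amount
  (\<open>directed_integral_descent\<close>), and the costs add up along the chain by the triangle inequality
  (\<open>telescoping_norm_bound\<close>).

  The bound on the second integral relies on the fact that multiplication by a unit pseudoscalar is
  an isometry (\<open>norm_unit_pseudoscalar_gprod\<close>): it is a product of unit vectors, and multiplication
  by a vector \<open>v\<close> is self-adjoint with square \<open>\<parallel>v\<parallel>\<^sup>2\<close>. The norm of a product of multivectors is not
  in general bounded by the product of the norms, so that this is not automatic.

  At the end of the chain \<open>S\<^sub>0\<close> is a finite sum, in which the orientation of the point \<open>x\<close> is a scalar
  \<open>\<plusminus> 1\<close>. The rule for the induced orientation identifies this scalar with the sign obtained by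
  comparing the tangent of \<open>N\<^sub>1\<close> with the outward normal (\<open>endpoint_sign_eq\<close>).
\<close>

section \<open>Unit pseudoscalars act by isometries\<close>

text \<open>
  Both sides can be nonzero only if \<open>A\<close> and \<open>B\<close> differ exactly by \<open>i\<close>. In that case the two signs
  agree because \<open>blade_sign {i} {i} = 1\<close>.
\<close>
lemma inner_basis_vector_gprod_blade:
  "(blade {i} \<odot> blade A) \<bullet> blade B = blade A \<bullet> (blade {i} \<odot> blade B)"
proof -
  have "{(a, b). a \<in> {i} \<and> b \<in> {i} \<and> b < a} = {}" by auto
  then have one: "blade_sign {i} {i} = 1" unfolding blade_sign_def by (simp only: card.empty) simp
  have iff: "sym_diff {i} A = B \<longleftrightarrow> A = sym_diff {i} B" by blast
  have "blade_sign {i} (sym_diff {i} A) = blade_sign {i} A"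
    by (simp only: blade_sign_sym_diff_right one mult_1_left)
  with iff show ?thesis
    by (simp only: gprod_blade inner_scaleR_left inner_scaleR_right inner_axis_axis) auto
qed

lemma inner_basis_vector_gprod:
  "(blade {i} \<odot> X) \<bullet> Y = X \<bullet> (blade {i} \<odot> Y)"
proof -
  have blade: "(blade {i} \<odot> X) \<bullet> blade B = X \<bullet> (blade {i} \<odot> blade B)" for B
    by (rule multivector_linear_eqI[where X = X])
       (auto intro!: linearI simp: gprod_right_simps inner_add_left inner_basis_vector_gprod_blade)
  show ?thesis
    by (rule multivector_linear_eqI[where X = Y])
       (auto intro!: linearI simp: gprod_right_simps inner_add_right blade)
qed

lemma inner_vector_gprod:
  "(mv_of_vec v \<odot> X) \<bullet> Y = X \<bullet> (mv_of_vec v \<odot> Y)"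
proof -
  have "mv_of_vec v \<odot> Z = (\<Sum>i\<in>UNIV. v $ i *\<^sub>R (blade {i} \<odot> Z))" for Z
  proof -
    have "linear (\<lambda>V. V \<odot> Z)" by (rule linearI) (simp_all add: gprod_left_simps)
    then show ?thesis
      by (simp add: mv_of_vec_def linear_sum[of "\<lambda>V. V \<odot> Z"] gprod_left_simps)
  qed
  then show ?thesis
    by (simp add: inner_sum_left inner_sum_right inner_basis_vector_gprod)
qed

lemma norm_vector_gprod: "norm (mv_of_vec v \<odot> X) = norm v * norm X"
proof -
  have "(norm (mv_of_vec v \<odot> X))\<^sup>2 = X \<bullet> ((mv_of_vec v \<odot> mv_of_vec v) \<odot> X)"
    by (simp add: power2_norm_eq_inner inner_vector_gprod gprod_assoc)
  also have "\<dots> = (norm v * norm X)\<^sup>2"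
    by (simp add: mv_of_vec_square gprod_left_simps gprod_one power_mult_distrib
        power2_norm_eq_inner)
  finally show ?thesis by (simp add: power2_eq_iff_nonneg)
qed

lemma norm_unit_pseudoscalar_gprod:
  assumes "unit_pseudoscalar k T J"
  shows "norm (J \<odot> X) = norm X"
proof -
  obtain ts s where ts: "orthonormal ts" and s: "s \<in> {-1, 1}"
    and J: "J = s *\<^sub>R foldr (\<odot>) (map mv_of_vec ts) mv_one"
    using assms unfolding unit_pseudoscalar_def by blast
  have "\<forall>t\<in>set ts. norm t = 1"
    using ts by (simp add: orthonormal_def)
  then have "norm (foldr (\<odot>) (map mv_of_vec ts) mv_one \<odot> X) = norm X"
    by (induction ts) (simp_all add: gprod_one gprod_assoc norm_vector_gprod)
  with s show ?thesis by (auto simp: J gprod_left_simps)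
qed

lemma norm_unit_pseudoscalar:
  assumes "unit_pseudoscalar k T J"
  shows "norm J = 1"
  using norm_unit_pseudoscalar_gprod[OF assms, of mv_one] by (simp add: gprod_one)

lemma unit_pseudoscalar_0:
  assumes "unit_pseudoscalar 0 T J"
  shows "J = mv_one \<or> J = - mv_one"
proof -
  obtain s where "s \<in> {-1, 1}" "J = s *\<^sub>R foldr (\<odot>) (map mv_of_vec []) (mv_one :: 'a multivector)"
    using assms unfolding unit_pseudoscalar_def length_0_conv by blast
  then show ?thesis by auto
qed

section \<open>Directed integrals\<close>

lemma directed_integrable_iff:
  "directed_integrable k N J g \<longleftrightarrow> set_integrable (volume_measure k) N (\<lambda>x. J x \<odot> g x)"
proof
  let ?h = "\<lambda>x. indicator N x *\<^sub>R (J x \<odot> g x)"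
  assume "directed_integrable k N J g"
  then have "integrable (volume_measure k) (\<lambda>x. (blade A \<bullet> ?h x) *\<^sub>R blade A)" for A
    by (auto simp: directed_integrable_def set_integrable_def mv_inner_eq
        intro!: integrable_scaleR_left)
  then have "integrable (volume_measure k) (\<lambda>x. \<Sum>A\<in>UNIV. (blade A \<bullet> ?h x) *\<^sub>R blade A)"
    by (intro Bochner_Integration.integrable_sum)
  moreover have "(\<Sum>A\<in>UNIV. (blade A \<bullet> X) *\<^sub>R blade A) = X" for X :: "'a multivector"
    by (subst (2) multivector_expansion) (simp add: inner_axis')
  ultimately show "set_integrable (volume_measure k) N (\<lambda>x. J x \<odot> g x)"
    unfolding set_integrable_def by (simp only:)
next
  assume "set_integrable (volume_measure k) N (\<lambda>x. J x \<odot> g x)"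
  then have "integrable (volume_measure k) (\<lambda>x. blade A \<bullet> (indicator N x *\<^sub>R (J x \<odot> g x)))" for A
    unfolding set_integrable_def by (rule integrable_inner_right)
  then show "directed_integrable k N J g"
    by (simp add: directed_integrable_def set_integrable_def mv_inner_eq)
qed

lemma directed_integrable_cong:
  assumes "\<And>x. x \<in> N \<Longrightarrow> g x = h x"
  shows "directed_integrable k N J g \<longleftrightarrow> directed_integrable k N J h"
  unfolding directed_integrable_iff set_integrable_def
  by (rule Bochner_Integration.integrable_cong) (auto simp: assms indicator_def)

lemma directed_integral_cong:
  assumes "\<And>x. x \<in> N \<Longrightarrow> g x = h x"
  shows "directed_integral k N J g = directed_integral k N J h"
  unfolding directed_integral_def set_lebesgue_integral_def
  by (rule Bochner_Integration.integral_cong) (auto simp: assms indicator_def)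

text \<open>
  Integrability on both parts already makes the integrands, extended by zero, measurable, so the
  sets themselves may be arbitrary.
\<close>
lemma directed_integral_Diff:
  assumes "E \<subseteq> N" "directed_integrable k (N - E) J g" "directed_integrable k E J g"
  shows "directed_integral k N J g = directed_integral k (N - E) J g + directed_integral k E J g"
proof -
  have "indicator N x *\<^sub>R (J x \<odot> g x)
      = indicator (N - E) x *\<^sub>R (J x \<odot> g x) + indicator E x *\<^sub>R (J x \<odot> g x)" for x
    using \<open>E \<subseteq> N\<close> by (auto simp: indicator_def)
  then show ?thesis
    using assms(2,3)
    unfolding directed_integral_def directed_integrable_iff set_lebesgue_integral_def
      set_integrable_def
    by simp
qed

text \<open>
  The outer measure of \<open>E\<close> is the measure of some measurable superset of \<open>E\<close>, on which the integrand
  extended by zero obeys the same bound.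
\<close>
lemma norm_directed_integral_le:
  assumes J: "\<And>x. x \<in> E \<Longrightarrow> unit_pseudoscalar k (T x) (J x)"
    and "directed_integrable k E J g"
  shows "ennreal (norm (directed_integral k E J g)) \<le> (SUP x\<in>E. ennreal (norm (g x))) * vol k E"
proof -
  let ?\<mu> = "volume_measure k :: 'a vector measure"
  let ?C = "SUP x\<in>E. ennreal (norm (g x))"
  have "space ?\<mu> = UNIV" by (simp add: volume_measure_def space_measure_of_conv)
  then obtain A where A: "A \<in> sets ?\<mu>" "E \<subseteq> A" "vol k E = emeasure ?\<mu> A"
    using outer_measure_of_attain[of E ?\<mu>] by (auto simp: vol_def)
  have "ennreal (norm (directed_integral k E J g))
      \<le> (\<integral>\<^sup>+x. norm (indicator E x *\<^sub>R (J x \<odot> g x)) \<partial>?\<mu>)"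
    using assms(2)
    unfolding directed_integral_def directed_integrable_iff set_lebesgue_integral_def
      set_integrable_def
    by (rule integral_norm_bound_ennreal)
  also have "\<dots> \<le> (\<integral>\<^sup>+x. ?C * indicator A x \<partial>?\<mu>)"
  proof (rule nn_integral_mono)
    fix x
    show "ennreal (norm (indicator E x *\<^sub>R (J x \<odot> g x))) \<le> ?C * indicator A x"
    proof (cases "x \<in> E")
      case True
      then have "norm (J x \<odot> g x) = norm (g x)"
        using J by (intro norm_unit_pseudoscalar_gprod)
      moreover have "ennreal (norm (g x)) \<le> ?C" using True by (rule SUP_upper)
      moreover have "x \<in> A" using True \<open>E \<subseteq> A\<close> by blast
      ultimately show ?thesis using True by simp
    qed simp
  qed
  also have "\<dots> = ?C * vol k E"
    using A by (simp add: nn_integral_cmult_indicator)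
  finally show ?thesis .
qed

section \<open>One step of the descent\<close>

lemma directed_integral_descent:
  assumes "E \<subseteq> N"
    and J: "\<And>x. x \<in> E \<Longrightarrow> unit_pseudoscalar (Suc k) (T x) (J x)"
    and antiderivative: "antiderivative_on (N - E) G g"
    and integrable: "directed_integrable (Suc k) E J g"
    and K: "boundary_orientation k (N - E) J K"
    and ftc: "fundamental_theorem_applies k (N - E) J G"
  shows "ennreal (norm (directed_integral (Suc k) N J g
             - directed_integral k (manifold_boundary (Suc k) (N - E)) K G))
         \<le> (SUP x\<in>E. ennreal (norm (g x))) * vol (Suc k) E"
proof -
  have deriv: "geometric_derivative (N - E) G x = g x" if "x \<in> N - E" for x
    using antiderivative that by (simp add: antiderivative_on_def)
  have applied: "directed_integrable (Suc k) (N - E) J (geometric_derivative (N - E) G) \<and>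
      directed_integral (Suc k) (N - E) J (geometric_derivative (N - E) G)
      = directed_integral k (manifold_boundary (Suc k) (N - E)) K G"
    using ftc[unfolded fundamental_theorem_applies_def, rule_format, OF K] by (elim conjE) (rule conjI)
  have "directed_integrable (Suc k) (N - E) J g"
    by (rule iffD1[OF directed_integrable_cong applied[THEN conjunct1]]) (rule deriv)
  then have "directed_integral (Suc k) N J g
      = directed_integral (Suc k) (N - E) J g + directed_integral (Suc k) E J g"
    using \<open>E \<subseteq> N\<close> integrable by (intro directed_integral_Diff)
  also have "directed_integral (Suc k) (N - E) J g
      = directed_integral (Suc k) (N - E) J (geometric_derivative (N - E) G)"
    by (rule directed_integral_cong) (rule deriv[symmetric])
  also have "\<dots> = directed_integral k (manifold_boundary (Suc k) (N - E)) K G"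
    using applied by (rule conjunct2)
  finally show ?thesis
    using norm_directed_integral_le[OF J integrable] by simp
qed

lemma telescoping_norm_bound:
  fixes S :: "nat \<Rightarrow> 'a::real_normed_vector" and c :: "nat \<Rightarrow> ennreal"
  assumes "\<And>i. i < m \<Longrightarrow> ennreal (norm (S (Suc i) - S i)) \<le> c (Suc i)"
  shows "ennreal (norm (S m - S 0)) \<le> (\<Sum>i=1..m. c i)"
  using assms
proof (induction m)
  case (Suc m)
  have "norm (S (Suc m) - S 0) \<le> norm (S (Suc m) - S m) + norm (S m - S 0)"
    using norm_triangle_ineq[of "S (Suc m) - S m" "S m - S 0"] by simp
  then have "ennreal (norm (S (Suc m) - S 0))
      \<le> ennreal (norm (S (Suc m) - S m)) + ennreal (norm (S m - S 0))"
    by (simp flip: ennreal_plus)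
  also have "\<dots> \<le> c (Suc m) + (\<Sum>i=1..m. c i)"
    using Suc by (intro add_mono) auto
  finally show ?case by (simp add: add.commute)
qed simp

section \<open>The end of the chain\<close>

lemma directed_integral_0:
  assumes "finite N"
  shows "directed_integral 0 N J g = (\<Sum>x\<in>N. J x \<odot> g x)"
proof -
  have "directed_integral 0 N J g = (\<integral>x. indicator N x *\<^sub>R (J x \<odot> g x) \<partial>count_space UNIV)"
    by (simp add: directed_integral_def set_lebesgue_integral_def volume_measure_def)
  also have "\<dots> = (\<Sum>x | x \<in> UNIV \<and> indicator N x *\<^sub>R (J x \<odot> g x) \<noteq> 0.
      indicator N x *\<^sub>R (J x \<odot> g x))"
    using assms
    by (intro lebesgue_integral_count_space_finite_support)
       (auto intro: finite_subset[of _ N] simp: indicator_def)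
  also have "\<dots> = (\<Sum>x\<in>N. J x \<odot> g x)"
    using assms by (intro sum.mono_neutral_cong_left) (auto simp: indicator_def)
  finally show ?thesis .
qed

text \<open>
  The induced orientation \<open>K x = \<plusminus> 1\<close> satisfies \<open>J x = K x n\<close>, where \<open>n\<close> is the outward normal. So
  \<open>K x = 1\<close> gives \<open>J x = n\<close>, and \<open>K x = -1\<close> gives \<open>J x = -n\<close>, which differs from \<open>n\<close> because \<open>J x\<close> is
  nonzero.
\<close>
lemma endpoint_sign_eq:
  assumes K: "boundary_orientation 0 N J K" and x: "x \<in> manifold_boundary 1 N"
    and "J x \<noteq> 0"
  shows "endpoint_sign N J x *\<^sub>R mv_one = K x"
proof -
  let ?n = "mv_of_vec (outward_normal 1 N x)"
  have J: "J x = K x \<odot> ?n" and "unit_pseudoscalar 0 (tangent_space (manifold_boundary 1 N) x) (K x)"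
    using K x by (auto simp: boundary_orientation_def orientation_def)
  then consider "K x = mv_one" | "K x = - mv_one"
    using unit_pseudoscalar_0 by blast
  then show ?thesis
  proof cases
    case 1
    with J show ?thesis by (simp add: endpoint_sign_def gprod_one)
  next
    case 2
    then have "K x = (-1) *\<^sub>R mv_one" by simp
    with J have "J x = - ?n" by (simp only: gprod_left_simps gprod_one) simp
    moreover from this have "J x \<noteq> ?n"
      using \<open>J x \<noteq> 0\<close> by (auto simp: vec_eq_iff)
    ultimately show ?thesis using 2 by (simp add: endpoint_sign_def)
  qed
qed

section \<open>Evaluation of an integral by repeated antiderivatives\<close>

theorem theorem3:
  fixes m :: nat
    and M :: "('n::{finite,linorder}) vector set"
    and f :: "'n vector \<Rightarrow> 'n multivector"
    and N :: "nat \<Rightarrow> 'n vector set"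
    and E :: "nat \<Rightarrow> 'n vector set"
    and F :: "nat \<Rightarrow> 'n vector \<Rightarrow> 'n multivector"
    and I :: "nat \<Rightarrow> 'n vector \<Rightarrow> 'n multivector"
  assumes "1 \<le> m"
    and "N m = M"
    and "F m = f"
    and "\<And>x. x \<in> M \<Longrightarrow> f x \<in> tangent_algebra M x"
    and "directed_integrable m M (I m) f"
    and manifolds: "\<And>i. i \<le> m \<Longrightarrow> vector_manifold i (N i)"
    and orientations: "\<And>i. i \<le> m \<Longrightarrow> orientation i (N i) (I i)"
    and nested: "\<And>i. i < m \<Longrightarrow> N i \<subseteq> N (Suc i)"
    and exceptional: "\<And>i. i \<in> {1..m} \<Longrightarrow> E i \<subseteq> N i \<and> bounded (E i)"
    and boundaries: "\<And>i. i < m \<Longrightarrow>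
      (if manifold_boundary (Suc i) (N (Suc i)) \<noteq> {}
       then N i = manifold_boundary (Suc i) (N (Suc i)) \<and> E (Suc i) = {}
       else N i = manifold_boundary (Suc i) (N (Suc i) - E (Suc i)) \<and>
            vector_manifold (Suc i) (N (Suc i) - E (Suc i)) \<and>
            vector_manifold i (manifold_boundary (Suc i) (N (Suc i) - E (Suc i))) \<and>
            manifold_boundary (Suc i) (N (Suc i) - E (Suc i)) \<noteq> {} \<and>
            directed_integrable (Suc i) (E (Suc i)) (I (Suc i)) (F (Suc i)) \<and>
            bounded (F (Suc i) ` E (Suc i)))"
    and antiderivatives: "\<And>i. i < m \<Longrightarrow>
      antiderivative_on (N (Suc i) - E (Suc i)) (F i) (F (Suc i)) \<and> bounded (F i ` N i)"
    and "finite (N 0)"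
    and induced: "\<And>i. i < m \<Longrightarrow>
      boundary_orientation i (N (Suc i) - E (Suc i)) (I (Suc i)) (I i)"
    and fundamental_theorem: "\<And>i. i < m \<Longrightarrow>
      fundamental_theorem_applies i (N (Suc i) - E (Suc i)) (I (Suc i)) (F i)"
  shows "ennreal (mv_norm (directed_integral m M (I m) f -
             (\<Sum>x\<in>N 0. endpoint_sign (N 1 - E 1) (I 1) x *\<^sub>R F 0 x)))
         \<le> (MAX i\<in>{1..m}. SUP x\<in>E i. ennreal (mv_norm (F i x))) * (\<Sum>i=1..m. vol i (E i))"
proof -
  define S where "S i = directed_integral i (N i) (I i) (F i)" for i
  let ?C = "\<lambda>i. SUP x\<in>E i. ennreal (norm (F i x))"
  have unit: "unit_pseudoscalar i (tangent_space (N i) x) (I i x)" if "i \<le> m" "x \<in> N i" for i x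
    using orientations[OF that(1)] that(2) by (simp add: orientation_def)
  have boundary: "manifold_boundary (Suc i) (N (Suc i) - E (Suc i)) = N i" if "i < m" for i
    using boundaries[OF that] by (auto split: if_splits)
  \<comment> \<open>Where \<open>N\<^bsub>i+1\<^esub>\<close> has a boundary of its own, \<open>E\<^bsub>i+1\<^esub>\<close> is empty and this is trivial.\<close>
  have integrable: "directed_integrable (Suc i) (E (Suc i)) (I (Suc i)) (F (Suc i))"
    if "i < m" for i
    using boundaries[OF that]
    by (auto simp: directed_integrable_iff set_integrable_def split: if_splits)
  have step: "ennreal (norm (S (Suc i) - S i)) \<le> ?C (Suc i) * vol (Suc i) (E (Suc i))"
    if "i < m" for i
  proof -
    have sub: "E (Suc i) \<subseteq> N (Suc i)"
      using exceptional[of "Suc i"] that by simp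
    moreover have "unit_pseudoscalar (Suc i) (tangent_space (N (Suc i)) x) (I (Suc i) x)"
      if "x \<in> E (Suc i)" for x
      using unit[of "Suc i" x] sub \<open>i < m\<close> that by auto
    ultimately show ?thesis
      using directed_integral_descent[where N = "N (Suc i)" and E = "E (Suc i)" and k = i
          and J = "I (Suc i)" and K = "I i" and G = "F i" and g = "F (Suc i)"
          and T = "tangent_space (N (Suc i))"]
        antiderivatives[OF that] integrable[OF that] induced[OF that] fundamental_theorem[OF that]
        boundary[OF that]
      by (simp add: S_def)
  qed
  have "0 < m" using \<open>1 \<le> m\<close> by simp
  have "endpoint_sign (N 1 - E 1) (I 1) x *\<^sub>R F 0 x = I 0 x \<odot> F 0 x" if "x \<in> N 0" for x
  proof -
    have "x \<in> N 1" using nested[OF \<open>0 < m\<close>] that by auto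
    then have "norm (I 1 x) = 1" using norm_unit_pseudoscalar[OF unit[OF \<open>1 \<le> m\<close>]] by blast
    then have "I 1 x \<noteq> 0" by auto
    then have "endpoint_sign (N 1 - E 1) (I 1) x *\<^sub>R mv_one = I 0 x"
      using induced[OF \<open>0 < m\<close>] boundary[OF \<open>0 < m\<close>] that by (intro endpoint_sign_eq) simp_all
    from this[symmetric] show ?thesis
      by (simp only: gprod_left_simps gprod_one)
  qed
  then have S0: "S 0 = (\<Sum>x\<in>N 0. endpoint_sign (N 1 - E 1) (I 1) x *\<^sub>R F 0 x)"
    using directed_integral_0[OF \<open>finite (N 0)\<close>] by (simp add: S_def)
  have "ennreal (norm (S m - S 0)) \<le> (\<Sum>i=1..m. ?C i * vol i (E i))"
    using step by (rule telescoping_norm_bound)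
  also have "\<dots> \<le> (\<Sum>i=1..m. (MAX i\<in>{1..m}. ?C i) * vol i (E i))"
    by (intro sum_mono mult_right_mono Max_ge) auto
  also have "\<dots> = (MAX i\<in>{1..m}. ?C i) * (\<Sum>i=1..m. vol i (E i))"
    by (simp add: sum_distrib_left)
  finally show ?thesis
    using \<open>N m = M\<close> \<open>F m = f\<close> by (simp add: mv_norm_eq S_def S0[unfolded S_def])
qed

end
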